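(* Let $\alpha,\beta\in\mathbb{R}$ with $\alpha\neq 0$. Let $(G_1,g)$ be the connected, simply connected three-dimensional Lie group with left-invariant Lorentzian metric $g$ whose Lie algebra has a pseudo-orthonormal basis $\{e_1,e_2,e_3\}$ with $e_3$ timelike satisfying $$[e_1,e_2]=\alpha e_1-\beta e_3,\quad [e_1,e_3]=-\alpha e_1-\beta e_2,\quad [e_2,e_3]=\beta e_1+\alpha e_2+\alpha e_3.$$ Then $(G_1,g)$ is an $Ein(2)$ manifold with scalars $\lambda_1,\lambda_2$ if and only if $\beta=0$, $\alpha\neq 0$ and $\lambda_1=\lambda_2=0$.
   Context: Pseudo-orthonormal basis with $e_3$ timelike means: the $e_i$ are left-invariant vector fields with $g(e_1,e_1)=g(e_2,e_2)=1$, $g(e_3,e_3)=-1$, $g(e_i,e_j)=0$ for $i\ne j$. Let $\nabla$ be the Levi-Civita connection of $g$, with curvature $R(X,Y)Z=\nabla_X\nabla_YZ-\nabla_Y\nabla_XZ-\nabla_{[X,Y]}Z$. The Ricci tensor is $\rho(X,Y)=-g(R(X,e_1)Y,e_1)-g(R(X,e_2)Y,e_2)+g(R(X,e_3)Y,e_3)$, and the Ricci operator $\rho^0$ is defined by $\rho(X,Y)=g(\rho^0(X),Y)$. The symmetric $(0,2)$-tensor $\rho^2$ is defined by $\rho^2(X,Y)=\rho(\rho^0X,Y)=g(\rho^0(X),\rho^0(Y))$. The manifold is called $Ein(2)$ (with scalars $\lambda_1,\lambda_2$) if $\rho^2+\lambda_1\rho+\lambda_2 g=0$ for scalars $\lambda_1,\lambda_2$.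 *)

theory Defs
  imports "HOL-Analysis.Analysis" "HOL-Algebra.Group" "HOL-Library.Function_Algebras"
begin

section \<open>Smooth maps between Euclidean spaces\<close>

text \<open>Only meant for open \<open>S\<close>. In finite dimension \<open>C\<close>-\<open>(n+1)\<close> is equivalent to
  differentiability together with all directional derivatives being \<open>C\<close>-\<open>n\<close>.\<close>

primrec k_smooth_on :: "nat \<Rightarrow> 'e::euclidean_space set \<Rightarrow> ('e \<Rightarrow> 'f::euclidean_space) \<Rightarrow> bool" where
  "k_smooth_on 0 = (\<lambda>S f. continuous_on S f)"
| "k_smooth_on (Suc n) = (\<lambda>S f. (\<forall>x\<in>S. f differentiable (at x)) \<and>
      (\<forall>v. k_smooth_on n S (\<lambda>x. frechet_derivative f (at x) v)))"

definition smooth_on :: "'e::euclidean_space set \<Rightarrow> ('e \<Rightarrow> 'f::euclidean_space) \<Rightarrow> bool" where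
  "smooth_on S f \<longleftrightarrow> (\<forall>n. k_smooth_on n S f)"

section \<open>Smooth manifolds\<close>

text \<open>The manifold is the whole type \<open>'a\<close>, modelled on the Euclidean space \<open>'e\<close>. A chart is its
  domain together with the coordinate map, whose values outside the domain are irrelevant.
  Atlases are not required to be maximal.\<close>

type_synonym ('a, 'e) chart = "'a set \<times> ('a \<Rightarrow> 'e)"

definition chart_inv :: "('a, 'e) chart \<Rightarrow> 'e \<Rightarrow> 'a" where
  "chart_inv c = inv_into (fst c) (snd c)"

definition smooth_atlas :: "('a::topological_space, 'e::euclidean_space) chart set \<Rightarrow> bool" where
  "smooth_atlas A \<longleftrightarrow>
     (\<forall>c\<in>A. open (fst c) \<and> open (snd c ` fst c) \<and>
        homeomorphism (fst c) (snd c ` fst c) (snd c) (chart_inv c)) \<and>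
     (\<Union>c\<in>A. fst c) = UNIV \<and>
     (\<forall>c\<in>A. \<forall>d\<in>A. smooth_on (snd c ` (fst c \<inter> fst d)) (snd d \<circ> chart_inv c))"

definition prod_atlas ::
    "('a, 'e) chart set \<Rightarrow> ('b, 'f) chart set \<Rightarrow> ('a \<times> 'b, 'e \<times> 'f) chart set" where
  "prod_atlas A B = {(fst c \<times> fst d, map_prod (snd c) (snd d)) | c d. c \<in> A \<and> d \<in> B}"

definition smooth_map :: "('a::topological_space, 'e::euclidean_space) chart set \<Rightarrow>
    ('b::topological_space, 'f::euclidean_space) chart set \<Rightarrow> ('a \<Rightarrow> 'b) \<Rightarrow> bool" where
  "smooth_map A B F \<longleftrightarrow> continuous_on UNIV F \<and>
     (\<forall>c\<in>A. \<forall>d\<in>B. smooth_on (snd c ` (fst c \<inter> F -` fst d)) (snd d \<circ> F \<circ> chart_inv c))"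

definition smooth_fun :: "('a, 'e::euclidean_space) chart set \<Rightarrow> ('a \<Rightarrow> real) \<Rightarrow> bool" where
  "smooth_fun A f \<longleftrightarrow> (\<forall>c\<in>A. smooth_on (snd c ` fst c) (f \<circ> chart_inv c))"

text \<open>An arbitrary chart around a point; all constructions using it are chart-independent.\<close>

definition chart_at :: "('a, 'e) chart set \<Rightarrow> 'a \<Rightarrow> ('a, 'e) chart" where
  "chart_at A p = (SOME c. c \<in> A \<and> p \<in> fst c)"

text \<open>A tangent vector at \<open>p\<close> is the family of its coordinate vectors in all charts around \<open>p\<close>, related
  by the derivatives of the chart changes. It is \<open>0\<close> on everything that is not a chart around \<open>p\<close>,
  so that equality of tangent vectors is equality of functions; addition is pointwise.\<close>

type_synonym ('a, 'e) tangent = "('a, 'e) chart \<Rightarrow> 'e"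

definition tangent_space ::
    "('a, 'e::euclidean_space) chart set \<Rightarrow> 'a \<Rightarrow> ('a, 'e) tangent set" where
  "tangent_space A p = {v.
     (\<forall>c. c \<notin> A \<or> p \<notin> fst c \<longrightarrow> v c = 0) \<and>
     (\<forall>c\<in>A. \<forall>d\<in>A. p \<in> fst c \<and> p \<in> fst d \<longrightarrow>
        v d = frechet_derivative (snd d \<circ> chart_inv c) (at (snd c p)) (v c))}"

definition differential :: "('a, 'e::euclidean_space) chart set \<Rightarrow> ('b, 'f::euclidean_space) chart set \<Rightarrow>
    ('a \<Rightarrow> 'b) \<Rightarrow> 'a \<Rightarrow> ('a, 'e) tangent \<Rightarrow> ('b, 'f) tangent" where
  "differential A B F p v = (\<lambda>d.
     if d \<in> B \<and> F p \<in> fst d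
     then let c = chart_at A p
          in frechet_derivative (snd d \<circ> F \<circ> chart_inv c) (at (snd c p)) (v c)
     else 0)"

section \<open>Vector fields\<close>

type_synonym ('a, 'e) vfield = "'a \<Rightarrow> ('a, 'e) tangent"

definition vfields :: "('a, 'e::euclidean_space) chart set \<Rightarrow> ('a, 'e) vfield set" where
  "vfields A = {X. (\<forall>p. X p \<in> tangent_space A p) \<and>
     (\<forall>c\<in>A. smooth_on (snd c ` fst c) (\<lambda>u. X (chart_inv c u) c))}"

definition vf_scale :: "('a \<Rightarrow> real) \<Rightarrow> ('a, 'e::real_vector) vfield \<Rightarrow> ('a, 'e) vfield"
    (infixr "*\<^sub>F" 75) where
  "f *\<^sub>F X = (\<lambda>p c. f p *\<^sub>R X p c)"

abbreviation vf_cscale :: "real \<Rightarrow> ('a, 'e::real_vector) vfield \<Rightarrow> ('a, 'e) vfield"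
    (infixr "*\<^sub>C" 75) where
  "a *\<^sub>C X \<equiv> (\<lambda>_. a) *\<^sub>F X"

text \<open>The derivative \<open>X f\<close> of a function along a vector field.\<close>

definition vf_deriv ::
    "('a, 'e::euclidean_space) chart set \<Rightarrow> ('a, 'e) vfield \<Rightarrow> ('a \<Rightarrow> real) \<Rightarrow> 'a \<Rightarrow> real" where
  "vf_deriv A X f p = (let c = chart_at A p
     in frechet_derivative (f \<circ> chart_inv c) (at (snd c p)) (X p c))"

text \<open>In coordinates \<open>[X, Y] = DY(X) - DX(Y)\<close>, so that \<open>[X, Y] f = X (Y f) - Y (X f)\<close>.\<close>

definition lie_bracket :: "('a, 'e::euclidean_space) chart set \<Rightarrow>
    ('a, 'e) vfield \<Rightarrow> ('a, 'e) vfield \<Rightarrow> ('a, 'e) vfield" where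
  "lie_bracket A X Y = (\<lambda>p c.
     if c \<in> A \<and> p \<in> fst c
     then frechet_derivative (\<lambda>u. Y (chart_inv c u) c) (at (snd c p)) (X p c)
        - frechet_derivative (\<lambda>u. X (chart_inv c u) c) (at (snd c p)) (Y p c)
     else 0)"

section \<open>Lorentzian metrics and curvature\<close>

type_synonym ('a, 'e) metric = "'a \<Rightarrow> ('a, 'e) tangent \<Rightarrow> ('a, 'e) tangent \<Rightarrow> real"

definition metric_fun :: "('a, 'e) metric \<Rightarrow> ('a, 'e) vfield \<Rightarrow> ('a, 'e) vfield \<Rightarrow> 'a \<Rightarrow> real" where
  "metric_fun g X Y = (\<lambda>p. g p (X p) (Y p))"

text \<open>The last conjunct gives the signature: each tangent space has a basis, indexed by the standard
  basis of the model space, in which the form is diagonal with exactly one entry \<open>-1\<close> and all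
  others \<open>1\<close>.\<close>

definition lorentzian_metric ::
    "('a, 'e::euclidean_space) chart set \<Rightarrow> ('a, 'e) metric \<Rightarrow> bool" where
  "lorentzian_metric A g \<longleftrightarrow>
     (\<forall>X\<in>vfields A. \<forall>Y\<in>vfields A. smooth_fun A (metric_fun g X Y)) \<and>
     (\<forall>p.
       (\<forall>u\<in>tangent_space A p. \<forall>v\<in>tangent_space A p. g p u v = g p v u) \<and>
       (\<forall>u\<in>tangent_space A p. \<forall>v\<in>tangent_space A p. \<forall>w\<in>tangent_space A p. \<forall>a b.
          g p (\<lambda>c. a *\<^sub>R u c + b *\<^sub>R v c) w = a * g p u w + b * g p v w) \<and>
       (\<forall>u\<in>tangent_space A p. (\<forall>v\<in>tangent_space A p. g p u v = 0) \<longrightarrow> u = 0) \<and>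
       (\<exists>b :: 'e \<Rightarrow> ('a, 'e) tangent. \<exists>t\<in>Basis. \<forall>i\<in>Basis. b i \<in> tangent_space A p \<and>
          (\<forall>j\<in>Basis. g p (b i) (b j) = (if i \<noteq> j then 0 else if i = t then -1 else 1))))"

text \<open>The Levi-Civita connection is the unique torsion-free metric affine connection; uniqueness
  concerns its values on \<^term>\<open>vfields A\<close>, the values on other arguments being irrelevant.\<close>

definition affine_connection :: "('a, 'e::euclidean_space) chart set \<Rightarrow>
    (('a, 'e) vfield \<Rightarrow> ('a, 'e) vfield \<Rightarrow> ('a, 'e) vfield) \<Rightarrow> bool" where
  "affine_connection A D \<longleftrightarrow>
     (\<forall>X\<in>vfields A. \<forall>Y\<in>vfields A. D X Y \<in> vfields A) \<and>
     (\<forall>X\<in>vfields A. \<forall>Y\<in>vfields A. \<forall>Z\<in>vfields A. D (X + Y) Z = D X Z + D Y Z) \<and>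
     (\<forall>X\<in>vfields A. \<forall>Y\<in>vfields A. \<forall>Z\<in>vfields A. D X (Y + Z) = D X Y + D X Z) \<and>
     (\<forall>X\<in>vfields A. \<forall>Y\<in>vfields A. \<forall>f. smooth_fun A f \<longrightarrow>
        D (f *\<^sub>F X) Y = f *\<^sub>F D X Y \<and>
        D X (f *\<^sub>F Y) = vf_deriv A X f *\<^sub>F Y + f *\<^sub>F D X Y)"

definition levi_civita :: "('a, 'e::euclidean_space) chart set \<Rightarrow> ('a, 'e) metric \<Rightarrow>
    (('a, 'e) vfield \<Rightarrow> ('a, 'e) vfield \<Rightarrow> ('a, 'e) vfield) \<Rightarrow> bool" where
  "levi_civita A g D \<longleftrightarrow> affine_connection A D \<and>
     (\<forall>X\<in>vfields A. \<forall>Y\<in>vfields A. D X Y - D Y X = lie_bracket A X Y) \<and>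
     (\<forall>X\<in>vfields A. \<forall>Y\<in>vfields A. \<forall>Z\<in>vfields A.
        vf_deriv A X (metric_fun g Y Z) = metric_fun g (D X Y) Z + metric_fun g Y (D X Z))"

definition curvature :: "('a, 'e::euclidean_space) chart set \<Rightarrow>
    (('a, 'e) vfield \<Rightarrow> ('a, 'e) vfield \<Rightarrow> ('a, 'e) vfield) \<Rightarrow>
    ('a, 'e) vfield \<Rightarrow> ('a, 'e) vfield \<Rightarrow> ('a, 'e) vfield \<Rightarrow> ('a, 'e) vfield" where
  "curvature A D X Y Z = D X (D Y Z) - D Y (D X Z) - D (lie_bracket A X Y) Z"

section \<open>Lie groups with a left-invariant metric\<close>

definition lie_group ::
    "('a::{t2_space,second_countable_topology}, 'm) monoid_scheme \<Rightarrow>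
     ('a, 'e::euclidean_space) chart set \<Rightarrow> bool" where
  "lie_group G A \<longleftrightarrow> group G \<and> carrier G = UNIV \<and> smooth_atlas A \<and>
     smooth_map (prod_atlas A A) A (\<lambda>(x, y). x \<otimes>\<^bsub>G\<^esub> y) \<and>
     smooth_map A A (\<lambda>x. inv\<^bsub>G\<^esub> x)"

definition lie_algebra :: "('a, 'm) monoid_scheme \<Rightarrow> ('a, 'e::euclidean_space) chart set \<Rightarrow>
    ('a, 'e) vfield set" where
  "lie_algebra G A = {X \<in> vfields A.
     \<forall>a p. X (a \<otimes>\<^bsub>G\<^esub> p) = differential A A (\<lambda>x. a \<otimes>\<^bsub>G\<^esub> x) p (X p)}"

definition left_invariant_metric :: "('a, 'm) monoid_scheme \<Rightarrow>
    ('a, 'e::euclidean_space) chart set \<Rightarrow> ('a, 'e) metric \<Rightarrow> bool" where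
  "left_invariant_metric G A g \<longleftrightarrow>
     (\<forall>a p. \<forall>u\<in>tangent_space A p. \<forall>v\<in>tangent_space A p.
        g (a \<otimes>\<^bsub>G\<^esub> p) (differential A A (\<lambda>x. a \<otimes>\<^bsub>G\<^esub> x) p u)
                  (differential A A (\<lambda>x. a \<otimes>\<^bsub>G\<^esub> x) p v) = g p u v)"

definition pseudo_orthonormal_basis :: "('a, 'm) monoid_scheme \<Rightarrow>
    ('a, 'e::euclidean_space) chart set \<Rightarrow> ('a, 'e) metric \<Rightarrow>
    ('a, 'e) vfield \<Rightarrow> ('a, 'e) vfield \<Rightarrow> ('a, 'e) vfield \<Rightarrow> bool" where
  "pseudo_orthonormal_basis G A g e1 e2 e3 \<longleftrightarrow>
     e1 \<in> lie_algebra G A \<and> e2 \<in> lie_algebra G A \<and> e3 \<in> lie_algebra G A \<and>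
     (\<forall>X\<in>lie_algebra G A. \<exists>!a :: real^3. X = a$1 *\<^sub>C e1 + a$2 *\<^sub>C e2 + a$3 *\<^sub>C e3) \<and>
     (\<forall>p. g p (e1 p) (e1 p) = 1 \<and> g p (e2 p) (e2 p) = 1 \<and> g p (e3 p) (e3 p) = -1 \<and>
          g p (e1 p) (e2 p) = 0 \<and> g p (e1 p) (e3 p) = 0 \<and> g p (e2 p) (e3 p) = 0)"

section \<open>Ricci tensor and the condition Ein(2)\<close>

text \<open>The Ricci tensor is computed in a pseudo-orthonormal frame whose last member is timelike.\<close>

definition ricci :: "('a, 'e::euclidean_space) chart set \<Rightarrow> ('a, 'e) metric \<Rightarrow>
    (('a, 'e) vfield \<Rightarrow> ('a, 'e) vfield \<Rightarrow> ('a, 'e) vfield) \<Rightarrow>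
    ('a, 'e) vfield \<Rightarrow> ('a, 'e) vfield \<Rightarrow> ('a, 'e) vfield \<Rightarrow>
    ('a, 'e) vfield \<Rightarrow> ('a, 'e) vfield \<Rightarrow> 'a \<Rightarrow> real" where
  "ricci A g D e1 e2 e3 X Y =
     - metric_fun g (curvature A D X e1 Y) e1
     - metric_fun g (curvature A D X e2 Y) e2
     + metric_fun g (curvature A D X e3 Y) e3"

definition ricci_operator :: "('a, 'e::euclidean_space) chart set \<Rightarrow> ('a, 'e) metric \<Rightarrow>
    (('a, 'e) vfield \<Rightarrow> ('a, 'e) vfield \<Rightarrow> ('a, 'e) vfield) \<Rightarrow>
    ('a, 'e) vfield \<Rightarrow> ('a, 'e) vfield \<Rightarrow> ('a, 'e) vfield \<Rightarrow>
    ('a, 'e) vfield \<Rightarrow> ('a, 'e) vfield" where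
  "ricci_operator A g D e1 e2 e3 X =
     (THE Z. Z \<in> vfields A \<and> (\<forall>Y\<in>vfields A. ricci A g D e1 e2 e3 X Y = metric_fun g Z Y))"

definition ricci_square :: "('a, 'e::euclidean_space) chart set \<Rightarrow> ('a, 'e) metric \<Rightarrow>
    (('a, 'e) vfield \<Rightarrow> ('a, 'e) vfield \<Rightarrow> ('a, 'e) vfield) \<Rightarrow>
    ('a, 'e) vfield \<Rightarrow> ('a, 'e) vfield \<Rightarrow> ('a, 'e) vfield \<Rightarrow>
    ('a, 'e) vfield \<Rightarrow> ('a, 'e) vfield \<Rightarrow> 'a \<Rightarrow> real" where
  "ricci_square A g D e1 e2 e3 X Y =
     ricci A g D e1 e2 e3 (ricci_operator A g D e1 e2 e3 X) Y"

definition ein2 :: "('a, 'e::euclidean_space) chart set \<Rightarrow> ('a, 'e) metric \<Rightarrow>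
    (('a, 'e) vfield \<Rightarrow> ('a, 'e) vfield \<Rightarrow> ('a, 'e) vfield) \<Rightarrow>
    ('a, 'e) vfield \<Rightarrow> ('a, 'e) vfield \<Rightarrow> ('a, 'e) vfield \<Rightarrow> real \<Rightarrow> real \<Rightarrow> bool" where
  "ein2 A g D e1 e2 e3 l1 l2 \<longleftrightarrow>
     (\<forall>X\<in>vfields A. \<forall>Y\<in>vfields A. \<forall>p.
        ricci_square A g D e1 e2 e3 X Y p + l1 * ricci A g D e1 e2 e3 X Y p
          + l2 * metric_fun g X Y p = 0)"

end

theory Submission
  imports Defs
begin

text \<open>
  The Koszul formula determines the Levi-Civita connection on the left-invariant frame from the
  structure constants, and the Ricci tensor then has the constant matrix
  \<open>\<rho>\<^sub>1\<^sub>1 = - \<beta>\<^sup>2 / 2\<close>, \<open>\<rho>\<^sub>1\<^sub>2 = - \<alpha> \<beta>\<close>, \<open>\<rho>\<^sub>1\<^sub>3 = \<alpha> \<beta>\<close>, \<open>\<rho>\<^sub>2\<^sub>2 = - 2 \<alpha>\<^sup>2 - \<beta>\<^sup>2 / 2\<close>,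
  \<open>\<rho>\<^sub>2\<^sub>3 = 2 \<alpha>\<^sup>2\<close>, \<open>\<rho>\<^sub>3\<^sub>3 = - 2 \<alpha>\<^sup>2 + \<beta>\<^sup>2 / 2\<close> (\<open>ricci_frame\<close>). The components \<open>(1,2)\<close> and \<open>(2,3)\<close> of
  \<open>\<rho>\<^sup>2 + \<lambda>\<^sub>1 \<rho> + \<lambda>\<^sub>2 g = 0\<close> are \<open>\<alpha> \<beta> (\<beta>\<^sup>2 - \<lambda>\<^sub>1) = 0\<close> and \<open>\<alpha>\<^sup>2 (2 \<lambda>\<^sub>1 - 3 \<beta>\<^sup>2) = 0\<close>. As \<open>\<alpha> \<noteq> 0\<close>, a
  nonzero \<open>\<beta>\<close> would give both \<open>\<lambda>\<^sub>1 = \<beta>\<^sup>2\<close> and \<open>\<lambda>\<^sub>1 = 3 \<beta>\<^sup>2 / 2\<close>; hence \<open>\<beta> = 0\<close> and \<open>\<lambda>\<^sub>1 = 0\<close>, and then the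
  component \<open>(1,1)\<close> is \<open>\<lambda>\<^sub>2 = 0\<close>. Conversely, for \<open>\<beta> = 0\<close> the Ricci operator is nilpotent of order
  two, so \<open>\<rho>\<^sup>2 = 0\<close>.

  Both the Ricci operator and the condition \<open>Ein(2)\<close> involve all smooth vector fields, whereas the
  matrix only describes left-invariant ones. The passage from one to the other is the
  tensoriality of \<open>\<rho>\<close> (\<open>tensorial_expansion\<close>, \<open>ricci_expand_left\<close>, \<open>ricci_expand_right\<close>), which
  rests on that of the curvature. The identity \<open>R(X,Y)(f Z) = f R(X,Y) Z\<close> amounts to
  \<open>[X,Y] f = X (Y f) - Y (X f)\<close> (\<open>vf_deriv_lie_bracket\<close>), and since the bracket is defined by
  derivatives of coordinate vectors, this is the symmetry of second derivatives
  (\<open>second_derivative_symmetric\<close>).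
\<close>

section \<open>Calculus of \<open>C\<close>-\<open>k\<close> maps on open sets\<close>

lemma k_smooth_on_cong:
  assumes "open S" and "\<And>x. x \<in> S \<Longrightarrow> f x = h x" and "k_smooth_on n S f"
  shows "k_smooth_on n S h"
  using assms(2,3)
proof (induction n arbitrary: f h)
  case 0
  then show ?case using continuous_on_eq[of S f h] by simp
next
  case (Suc n)
  have fd: "f differentiable (at x)" if "x \<in> S" for x
    using Suc.prems that by simp
  have hd: "(h has_derivative frechet_derivative f (at x)) (at x)" if "x \<in> S" for x
    using has_derivative_transform_within_open[OF _ assms(1) that, of f _ UNIV h]
      fd[OF that] Suc.prems(1) frechet_derivative_works by blast
  have "frechet_derivative h (at x) = frechet_derivative f (at x)" if "x \<in> S" for x
    using frechet_derivative_at[OF hd[OF that]] by simp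
  with Suc.prems Suc.IH have "k_smooth_on n S (\<lambda>x. frechet_derivative h (at x) v)" for v
    by (smt (verit) k_smooth_on.simps(2))
  moreover have "\<forall>x\<in>S. h differentiable (at x)"
    using hd differentiable_def by blast
  ultimately show ?case by simp
qed

lemma k_smooth_on_SucD: "k_smooth_on (Suc n) S f \<Longrightarrow> k_smooth_on n S f"
proof (induction n arbitrary: f)
  case 0
  then show ?case
    by (auto intro!: continuous_at_imp_continuous_on differentiable_imp_continuous_within)
next
  case (Suc n)
  then show ?case by (metis k_smooth_on.simps(2))
qed

lemma k_smooth_on_const: "k_smooth_on n S (\<lambda>_. c)"
  by (induction n arbitrary: c) auto

lemma k_smooth_on_add:
  assumes "open S" and "k_smooth_on n S f" and "k_smooth_on n S h"
  shows "k_smooth_on n S (\<lambda>x. f x + h x)"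
  using assms(2,3)
proof (induction n arbitrary: f h)
  case 0
  then show ?case by (simp add: continuous_on_add)
next
  case (Suc n)
  have "k_smooth_on n S (\<lambda>x. frechet_derivative (\<lambda>x. f x + h x) (at x) v)" for v
  proof (rule k_smooth_on_cong[OF assms(1)])
    show "k_smooth_on n S (\<lambda>x. frechet_derivative f (at x) v + frechet_derivative h (at x) v)"
      using Suc by simp
    show "frechet_derivative f (at x) v + frechet_derivative h (at x) v =
        frechet_derivative (\<lambda>x. f x + h x) (at x) v" if "x \<in> S" for x
    proof -
      have "((\<lambda>x. f x + h x) has_derivative
          (\<lambda>v. frechet_derivative f (at x) v + frechet_derivative h (at x) v)) (at x)"
        using Suc.prems that by (intro has_derivative_add) (auto simp: frechet_derivative_works[symmetric])
      from frechet_derivative_at[OF this] show ?thesis by metis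
    qed
  qed
  with Suc.prems show ?case by simp
qed

lemma k_smooth_on_scaleR:
  fixes f :: "_ \<Rightarrow> real"
  assumes "open S" and "k_smooth_on n S f" and "k_smooth_on n S h"
  shows "k_smooth_on n S (\<lambda>x. f x *\<^sub>R h x)"
  using assms(2,3)
proof (induction n arbitrary: f h)
  case 0
  then show ?case by (simp add: continuous_on_scaleR)
next
  case (Suc n)
  have "((\<lambda>x. f x *\<^sub>R h x) has_derivative
      (\<lambda>v. f x *\<^sub>R frechet_derivative h (at x) v + frechet_derivative f (at x) v *\<^sub>R h x)) (at x)"
    if "x \<in> S" for x
    using Suc.prems that
    by (intro has_derivative_scaleR) (auto simp: frechet_derivative_works[symmetric])
  note der = this
  have "k_smooth_on n S (\<lambda>x. frechet_derivative (\<lambda>x. f x *\<^sub>R h x) (at x) v)" for v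
  proof (rule k_smooth_on_cong[OF assms(1)])
    show "k_smooth_on n S
        (\<lambda>x. f x *\<^sub>R frechet_derivative h (at x) v + frechet_derivative f (at x) v *\<^sub>R h x)"
      using Suc.prems k_smooth_on_SucD[OF Suc.prems(1)] k_smooth_on_SucD[OF Suc.prems(2)]
      by (intro k_smooth_on_add[OF assms(1)] Suc.IH) auto
    show "f x *\<^sub>R frechet_derivative h (at x) v + frechet_derivative f (at x) v *\<^sub>R h x =
        frechet_derivative (\<lambda>x. f x *\<^sub>R h x) (at x) v" if "x \<in> S" for x
      using frechet_derivative_at[OF der[OF that]] by metis
  qed
  moreover have "\<forall>x\<in>S. (\<lambda>x. f x *\<^sub>R h x) differentiable (at x)"
    using der differentiable_def by blast
  ultimately show ?case by simp
qed

lemma smooth_on_const: "smooth_on S (\<lambda>_. c)"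
  unfolding smooth_on_def by (simp add: k_smooth_on_const)

lemma smooth_on_add:
  "open S \<Longrightarrow> smooth_on S f \<Longrightarrow> smooth_on S h \<Longrightarrow> smooth_on S (\<lambda>x. f x + h x)"
  unfolding smooth_on_def by (simp add: k_smooth_on_add)

lemma smooth_on_scaleR:
  fixes f :: "_ \<Rightarrow> real"
  shows "open S \<Longrightarrow> smooth_on S f \<Longrightarrow> smooth_on S h \<Longrightarrow> smooth_on S (\<lambda>x. f x *\<^sub>R h x)"
  unfolding smooth_on_def by (simp add: k_smooth_on_scaleR)

lemma smooth_on_differentiable: "smooth_on S f \<Longrightarrow> x \<in> S \<Longrightarrow> f differentiable (at x)"
  unfolding smooth_on_def by (drule spec[of _ "Suc 0"]) simp

text \<open>The right-hand side is a mixed second derivative in the order \<open>v\<close>, \<open>w\<close>, but the difference on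
  the left is symmetric in \<open>v\<close> and \<open>w\<close>.\<close>

lemma second_difference_mean_value:
  fixes f :: "'e::euclidean_space \<Rightarrow> real"
  assumes f: "k_smooth_on 2 S f" and ball: "ball x r \<subseteq> S"
    and h: "h > 0" "h * (norm v + norm w) < r"
  shows "\<exists>s t. 0 < s \<and> s < h \<and> 0 < t \<and> t < h \<and>
    f (x + h *\<^sub>R v + h *\<^sub>R w) - f (x + h *\<^sub>R v) - f (x + h *\<^sub>R w) + f x =
    h * h * frechet_derivative (\<lambda>u. frechet_derivative f (at u) v) (at (x + s *\<^sub>R v + t *\<^sub>R w)) w"
proof -
  have inS: "x + s *\<^sub>R v + t *\<^sub>R w \<in> S" if "0 \<le> s" "s \<le> h" "0 \<le> t" "t \<le> h" for s t
  proof -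
    have "norm (s *\<^sub>R v + t *\<^sub>R w) \<le> s * norm v + t * norm w"
      using that norm_triangle_ineq[of "s *\<^sub>R v" "t *\<^sub>R w"] by simp
    also have "\<dots> \<le> h * norm v + h * norm w"
      using that by (intro add_mono mult_right_mono) auto
    finally have "norm (s *\<^sub>R v + t *\<^sub>R w) < r"
      using h by (simp add: distrib_left)
    then have "x + (s *\<^sub>R v + t *\<^sub>R w) \<in> ball x r"
      by (simp add: dist_norm flip: minus_add_distrib)
    with ball show ?thesis by (auto simp: add.assoc)
  qed
  have df: "(f has_derivative frechet_derivative f (at u)) (at u)" if "u \<in> S" for u
    using f that by (simp add: numeral_2_eq_2 frechet_derivative_works[symmetric])
  have ddf: "((\<lambda>u. frechet_derivative f (at u) v) has_derivative
      frechet_derivative (\<lambda>u. frechet_derivative f (at u) v) (at u)) (at u)" if "u \<in> S" for u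
    using f that by (simp add: numeral_2_eq_2 frechet_derivative_works[symmetric])
  have line: "((\<lambda>s. F (a + s *\<^sub>R v')) has_real_derivative F' v') (at s)"
    if "(F has_derivative F') (at (a + s *\<^sub>R v'))" for F :: "'e \<Rightarrow> real" and F' a s v'
  proof -
    have "((\<lambda>s. a + s *\<^sub>R v') has_derivative (\<lambda>t. t *\<^sub>R v')) (at s)"
      by (auto intro!: derivative_eq_intros)
    from has_derivative_compose[OF this that]
    have "((\<lambda>s. F (a + s *\<^sub>R v')) has_derivative (\<lambda>t. F' (t *\<^sub>R v'))) (at s)" .
    moreover have "F' (t *\<^sub>R v') = F' v' * t" for t
      using has_derivative_linear[OF that] by (simp add: linear_cmul)
    ultimately show ?thesis
      by (simp add: has_field_derivative_def)
  qed
  \<comment> \<open>The mean value theorem is applied in the direction \<open>v\<close>, then in the direction \<open>w\<close>.\<close>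
  define \<phi> where "\<phi> s = f ((x + h *\<^sub>R w) + s *\<^sub>R v) - f (x + s *\<^sub>R v)" for s
  have "\<exists>s. 0 < s \<and> s < h \<and> \<phi> h - \<phi> 0 = (h - 0) *
      (frechet_derivative f (at ((x + h *\<^sub>R w) + s *\<^sub>R v)) v - frechet_derivative f (at (x + s *\<^sub>R v)) v)"
  proof (rule MVT2[OF h(1)])
    fix s assume s: "0 \<le> s" "s \<le> h"
    have "x + h *\<^sub>R w + s *\<^sub>R v \<in> S" "x + s *\<^sub>R v \<in> S"
      using inS[of s h] inS[of s 0] s h by (auto simp: algebra_simps)
    then show "(\<phi> has_real_derivative frechet_derivative f (at ((x + h *\<^sub>R w) + s *\<^sub>R v)) v -
        frechet_derivative f (at (x + s *\<^sub>R v)) v) (at s)"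
      unfolding \<phi>_def by (intro DERIV_diff line df)
  qed
  then obtain s where s: "0 < s" "s < h" and 1: "\<phi> h - \<phi> 0 = h *
      (frechet_derivative f (at ((x + h *\<^sub>R w) + s *\<^sub>R v)) v - frechet_derivative f (at (x + s *\<^sub>R v)) v)"
    by auto
  define \<psi> where "\<psi> t = frechet_derivative f (at ((x + s *\<^sub>R v) + t *\<^sub>R w)) v" for t
  have "\<exists>t. 0 < t \<and> t < h \<and> \<psi> h - \<psi> 0 = (h - 0) *
      frechet_derivative (\<lambda>u. frechet_derivative f (at u) v) (at ((x + s *\<^sub>R v) + t *\<^sub>R w)) w"
  proof (rule MVT2[OF h(1)])
    fix t assume "0 \<le> t" "t \<le> h"
    then show "(\<psi> has_real_derivative
        frechet_derivative (\<lambda>u. frechet_derivative f (at u) v) (at ((x + s *\<^sub>R v) + t *\<^sub>R w)) w) (at t)"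
      unfolding \<psi>_def using s by (intro line ddf inS) auto
  qed
  then obtain t where t: "0 < t" "t < h" and 2: "\<psi> h - \<psi> 0 = h *
      frechet_derivative (\<lambda>u. frechet_derivative f (at u) v) (at ((x + s *\<^sub>R v) + t *\<^sub>R w)) w"
    by auto
  have "f (x + h *\<^sub>R v + h *\<^sub>R w) - f (x + h *\<^sub>R v) - f (x + h *\<^sub>R w) + f x = \<phi> h - \<phi> 0"
    by (simp add: \<phi>_def algebra_simps)
  also have "\<dots> = h * (\<psi> h - \<psi> 0)"
    unfolding 1 \<psi>_def by (simp add: algebra_simps)
  finally show ?thesis using s t 2 by (intro exI[of _ s] exI[of _ t]) simp
qed

lemma second_derivative_symmetric:
  fixes f :: "'e::euclidean_space \<Rightarrow> real"
  assumes f: "k_smooth_on 2 S f" and S: "open S" "x \<in> S"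
  shows "frechet_derivative (\<lambda>u. frechet_derivative f (at u) v) (at x) w =
    frechet_derivative (\<lambda>u. frechet_derivative f (at u) w) (at x) v"
proof (rule ccontr)
  define H where "H v w u = frechet_derivative (\<lambda>u. frechet_derivative f (at u) v) (at u) w" for v w u
  assume "\<not> ?thesis"
  then have e: "\<bar>H v w x - H w v x\<bar> / 2 > 0" (is "?e > 0") by (simp add: H_def)
  have cont: "continuous_on S (H v w)" for v w
    using f unfolding H_def by (simp add: numeral_2_eq_2)
  have "\<exists>d>0. \<forall>y\<in>S. dist y x < d \<longrightarrow> dist (H v w y) (H v w x) < ?e" for v w
    using cont[of v w] S(2) e unfolding continuous_on_iff by blast
  then obtain d1 d2 where d: "d1 > 0" "d2 > 0"
    and d1: "\<And>y. y \<in> S \<Longrightarrow> dist y x < d1 \<Longrightarrow> dist (H v w y) (H v w x) < ?e"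
    and d2: "\<And>y. y \<in> S \<Longrightarrow> dist y x < d2 \<Longrightarrow> dist (H w v y) (H w v x) < ?e"
    by meson
  obtain r0 where r0: "r0 > 0" "ball x r0 \<subseteq> S"
    using S openE by blast
  \<comment> \<open>On the ball of radius \<open>r\<close> each mixed derivative differs from its value at \<open>x\<close> by less than half
    the gap between the two values; the step \<open>h\<close> keeps all points concerned inside that ball.\<close>
  define r where "r = min r0 (min d1 d2)"
  have r: "r > 0" "ball x r \<subseteq> S" "r \<le> d1" "r \<le> d2"
    using r0 d by (auto simp: r_def)
  define h where "h = r / (2 * (norm v + norm w + 1))"
  have nz: "norm v + norm w + 1 > 0" by (simp add: add_nonneg_pos)
  have h: "h > 0" using r nz by (simp add: h_def)
  have "h * (norm v + norm w) < h * (2 * (norm v + norm w + 1))"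
    using h nz by (intro mult_strict_left_mono) auto
  also have "\<dots> = r" using nz by (simp add: h_def)
  finally have hr: "h * (norm v + norm w) < r" .
  then have hr': "h * (norm w + norm v) < r" by (simp add: add.commute)
  have near: "dist (x + a) x < r" if "norm a \<le> h * (norm v + norm w)" for a
    using that hr by (simp add: dist_norm)
  have bound: "norm (s *\<^sub>R v' + t *\<^sub>R w') \<le> h * (norm v' + norm w')"
    if "0 < s" "s < h" "0 < t" "t < h" for s t and v' w' :: 'e
  proof -
    have "norm (s *\<^sub>R v' + t *\<^sub>R w') \<le> s * norm v' + t * norm w'"
      using that norm_triangle_ineq[of "s *\<^sub>R v'" "t *\<^sub>R w'"] by simp
    also have "\<dots> \<le> h * norm v' + h * norm w'"
      using that by (intro add_mono mult_right_mono) auto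
    finally show ?thesis by (simp add: distrib_left)
  qed
  obtain s t where st: "0 < s" "s < h" "0 < t" "t < h"
    and eq1: "f (x + h *\<^sub>R v + h *\<^sub>R w) - f (x + h *\<^sub>R v) - f (x + h *\<^sub>R w) + f x =
      h * h * H v w (x + s *\<^sub>R v + t *\<^sub>R w)"
    using second_difference_mean_value[OF f r(2) h hr] unfolding H_def by blast
  obtain s' t' where st': "0 < s'" "s' < h" "0 < t'" "t' < h"
    and eq2: "f (x + h *\<^sub>R w + h *\<^sub>R v) - f (x + h *\<^sub>R w) - f (x + h *\<^sub>R v) + f x =
      h * h * H w v (x + s' *\<^sub>R w + t' *\<^sub>R v)"
    using second_difference_mean_value[OF f r(2) h hr'] unfolding H_def by blast
  have swap: "x + h *\<^sub>R w + h *\<^sub>R v = x + h *\<^sub>R v + h *\<^sub>R w" by (simp add: algebra_simps)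
  have "h * h * H v w (x + s *\<^sub>R v + t *\<^sub>R w) = h * h * H w v (x + s' *\<^sub>R w + t' *\<^sub>R v)"
    unfolding eq1[symmetric] eq2[symmetric] swap by simp
  then have eq: "H v w (x + s *\<^sub>R v + t *\<^sub>R w) = H w v (x + s' *\<^sub>R w + t' *\<^sub>R v)"
    using h by simp
  have n1: "dist (x + s *\<^sub>R v + t *\<^sub>R w) x < r"
    using near[OF bound[OF st]] by (simp add: add.assoc)
  have n2: "dist (x + s' *\<^sub>R w + t' *\<^sub>R v) x < r"
    using near[of "s' *\<^sub>R w + t' *\<^sub>R v"] bound[OF st', of w v]
    by (simp add: add.assoc add.commute[of "norm v"])
  have "x + s *\<^sub>R v + t *\<^sub>R w \<in> S" "x + s' *\<^sub>R w + t' *\<^sub>R v \<in> S"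
    using n1 n2 r(2) by (auto simp: dist_commute)
  then have "dist (H v w (x + s *\<^sub>R v + t *\<^sub>R w)) (H v w x) < ?e"
    "dist (H w v (x + s' *\<^sub>R w + t' *\<^sub>R v)) (H w v x) < ?e"
    using d1 d2 n1 n2 r(3,4) by auto
  then show False unfolding eq dist_real_def by (auto simp: abs_if split: if_splits)
qed

text \<open>Linearity of the differential turns \<open>F'(u)(Y u)\<close> into a sum over the standard basis, which
  can be differentiated term by term.\<close>

lemma has_derivative_derivative_along:
  fixes F :: "'e::euclidean_space \<Rightarrow> real"
  assumes F: "k_smooth_on 2 S F" and S: "open S" "x \<in> S" and Y: "(Y has_derivative Y') (at x)"
  shows "((\<lambda>u. frechet_derivative F (at u) (Y u)) has_derivative
    (\<lambda>h. frechet_derivative (\<lambda>u. frechet_derivative F (at u) (Y x)) (at x) h +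
         frechet_derivative F (at x) (Y' h))) (at x)"
proof -
  have dF: "F differentiable (at u)" if "u \<in> S" for u
    using F that by (simp add: numeral_2_eq_2)
  have lin: "linear (frechet_derivative F (at u))" if "u \<in> S" for u
    using dF[OF that] by (rule linear_frechet_derivative)
  have expand: "frechet_derivative F (at u) v = (\<Sum>b\<in>Basis. (v \<bullet> b) * frechet_derivative F (at u) b)"
    if "u \<in> S" for u v
    using Linear_Algebra.linear_componentwise[OF lin[OF that], of v 1] 
    by simp
  have dd: "((\<lambda>u. frechet_derivative F (at u) b) has_derivative
      frechet_derivative (\<lambda>u. frechet_derivative F (at u) b) (at x)) (at x)" for b
    using F S by (simp add: numeral_2_eq_2 frechet_derivative_works[symmetric])
  have along: "((\<lambda>u. frechet_derivative F (at u) (Z u)) has_derivative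
      (\<lambda>h. (\<Sum>b\<in>Basis. (Z x \<bullet> b) * frechet_derivative (\<lambda>u. frechet_derivative F (at u) b) (at x) h) +
         frechet_derivative F (at x) (Z' h))) (at x)"
    if Z: "(Z has_derivative Z') (at x)" for Z Z'
  proof -
    have "((\<lambda>u. \<Sum>b\<in>Basis. (Z u \<bullet> b) * frechet_derivative F (at u) b) has_derivative
       (\<lambda>h. \<Sum>b\<in>Basis. (Z x \<bullet> b) * frechet_derivative (\<lambda>u. frechet_derivative F (at u) b) (at x) h +
          (Z' h \<bullet> b) * frechet_derivative F (at x) b)) (at x)"
      by (intro has_derivative_sum has_derivative_mult has_derivative_inner_left Z dd)
    then have "((\<lambda>u. \<Sum>b\<in>Basis. (Z u \<bullet> b) * frechet_derivative F (at u) b) has_derivative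
      (\<lambda>h. (\<Sum>b\<in>Basis. (Z x \<bullet> b) * frechet_derivative (\<lambda>u. frechet_derivative F (at u) b) (at x) h) +
         frechet_derivative F (at x) (Z' h))) (at x)"
      by (simp add: sum.distrib expand[OF S(2), of "Z' _"])
    then show ?thesis
      by (rule has_derivative_transform_within_open[OF _ S]) (simp add: expand[of _ "Z _"])
  qed
  \<comment> \<open>The case of a constant field identifies the sum with a second derivative of \<open>F\<close>.\<close>
  have const: "frechet_derivative (\<lambda>u. frechet_derivative F (at u) v) (at x) =
      (\<lambda>h. \<Sum>b\<in>Basis. (v \<bullet> b) * frechet_derivative (\<lambda>u. frechet_derivative F (at u) b) (at x) h)" for v
    using along[OF has_derivative_const[of v]]
    unfolding linear_0[OF lin[OF S(2)]] add_0_right by (rule frechet_derivative_at[symmetric])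
  show ?thesis unfolding const[of "Y x"] by (rule along[OF Y])
qed


section \<open>Vector fields on a smooth manifold\<close>

text \<open>The whole type \<open>'a\<close> with a smooth atlas, without any group structure.\<close>

locale manifold =
  fixes A :: "('a::topological_space, 'e::euclidean_space) chart set"
  assumes atlas: "smooth_atlas A"
begin

lemma chart_at: "chart_at A p \<in> A" "p \<in> fst (chart_at A p)"
proof -
  have "\<exists>c. c \<in> A \<and> p \<in> fst c"
    using atlas unfolding smooth_atlas_def by blast
  from someI_ex[OF this] show "chart_at A p \<in> A" "p \<in> fst (chart_at A p)"
    unfolding chart_at_def by auto
qed

lemma chart_homeomorphism:
  "c \<in> A \<Longrightarrow> homeomorphism (fst c) (snd c ` fst c) (snd c) (chart_inv c)"
  using atlas unfolding smooth_atlas_def by blast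

lemma chart_inv_chart: "c \<in> A \<Longrightarrow> p \<in> fst c \<Longrightarrow> chart_inv c (snd c p) = p"
  using chart_homeomorphism unfolding homeomorphism_def by blast

lemma open_chart: "c \<in> A \<Longrightarrow> open (fst c)"
  using atlas unfolding smooth_atlas_def by blast

lemma open_chart_image: "c \<in> A \<Longrightarrow> open (snd c ` fst c)"
  using atlas unfolding smooth_atlas_def by blast

lemma open_chart_image_Int:
  assumes "c \<in> A" and "open U"
  shows "open (snd c ` (fst c \<inter> U))"
proof -
  have "openin (top_of_set (snd c ` fst c)) (snd c ` (fst c \<inter> U))"
    using homeomorphism_imp_open_map[OF chart_homeomorphism[OF assms(1)]] assms(2)
    by (simp add: openin_open_Int)
  then show ?thesis
    using open_chart_image[OF assms(1)] openin_open_trans by blast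
qed

lemma transition_differentiable:
  assumes "c \<in> A" "d \<in> A" "p \<in> fst c" "p \<in> fst d"
  shows "(snd d \<circ> chart_inv c) differentiable (at (snd c p))"
proof -
  have "smooth_on (snd c ` (fst c \<inter> fst d)) (snd d \<circ> chart_inv c)"
    using atlas assms unfolding smooth_atlas_def by blast
  then show ?thesis
    using assms by (intro smooth_on_differentiable) auto
qed

lemma tangent_spaceD:
  "u \<in> tangent_space A p \<Longrightarrow> c \<notin> A \<or> p \<notin> fst c \<Longrightarrow> u c = 0"
  "u \<in> tangent_space A p \<Longrightarrow> c \<in> A \<Longrightarrow> d \<in> A \<Longrightarrow> p \<in> fst c \<Longrightarrow> p \<in> fst d \<Longrightarrow>
    u d = frechet_derivative (snd d \<circ> chart_inv c) (at (snd c p)) (u c)"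
  unfolding tangent_space_def by blast+

lemma tangent_space_combination:
  assumes u: "u \<in> tangent_space A p" and v: "v \<in> tangent_space A p"
  shows "(\<lambda>c. a *\<^sub>R u c + b *\<^sub>R v c) \<in> tangent_space A p"
  unfolding tangent_space_def
proof (intro CollectI conjI allI ballI impI)
  fix c d assume cd: "c \<in> A" "d \<in> A" "p \<in> fst c \<and> p \<in> fst d"
  then have "linear (frechet_derivative (snd d \<circ> chart_inv c) (at (snd c p)))"
    by (intro linear_frechet_derivative transition_differentiable) auto
  then show "a *\<^sub>R u d + b *\<^sub>R v d =
      frechet_derivative (snd d \<circ> chart_inv c) (at (snd c p)) (a *\<^sub>R u c + b *\<^sub>R v c)"
    using tangent_spaceD(2)[OF u cd(1,2)] tangent_spaceD(2)[OF v cd(1,2)] cd(3)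
    by (simp add: linear_add linear_cmul)
qed (simp add: tangent_spaceD(1)[OF u] tangent_spaceD(1)[OF v])

lemma tangent_space_add: "u \<in> tangent_space A p \<Longrightarrow> v \<in> tangent_space A p \<Longrightarrow> u + v \<in> tangent_space A p"
  using tangent_space_combination[of u p v 1 1] by (simp add: plus_fun_def)

lemma tangent_space_scale: "u \<in> tangent_space A p \<Longrightarrow> (\<lambda>c. a *\<^sub>R u c) \<in> tangent_space A p"
  using tangent_space_combination[of u p u a 0] by simp

text \<open>Evaluation in a single chart is injective on the tangent space.\<close>

lemma tangent_space_eq_0:
  assumes "u \<in> tangent_space A p" "c \<in> A" "p \<in> fst c" "u c = 0"
  shows "u = 0"
proof
  fix d
  show "u d = 0 d"
  proof (cases "d \<in> A \<and> p \<in> fst d")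
    case True
    then have "u d = frechet_derivative (snd d \<circ> chart_inv c) (at (snd c p)) (u c)"
      using assms unfolding tangent_space_def by blast
    then show ?thesis
      using linear_0[OF linear_frechet_derivative[OF transition_differentiable[of c d p]]] True assms
      by simp
  next
    case False
    then show ?thesis using tangent_spaceD(1)[OF assms(1)] by auto
  qed
qed

lemma vfields_tangent: "X \<in> vfields A \<Longrightarrow> X p \<in> tangent_space A p"
  unfolding vfields_def by blast

lemma vfields_smooth: "X \<in> vfields A \<Longrightarrow> c \<in> A \<Longrightarrow> smooth_on (snd c ` fst c) (\<lambda>u. X (chart_inv c u) c)"
  unfolding vfields_def by blast

lemma smooth_fun_smooth: "smooth_fun A f \<Longrightarrow> c \<in> A \<Longrightarrow> smooth_on (snd c ` fst c) (\<lambda>u. f (chart_inv c u))"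
  unfolding smooth_fun_def o_def by blast

lemma smooth_fun_const: "smooth_fun A (\<lambda>_. a)"
  unfolding smooth_fun_def o_def by (simp add: smooth_on_const)

lemma smooth_fun_add:
  assumes "smooth_fun A f" "smooth_fun A h"
  shows "smooth_fun A (f + h)"
  unfolding smooth_fun_def o_def plus_fun_def
  by (intro ballI smooth_on_add open_chart_image smooth_fun_smooth assms)

lemma smooth_fun_mult:
  assumes "smooth_fun A f" "smooth_fun A h"
  shows "smooth_fun A (f * h)"
  unfolding smooth_fun_def o_def times_fun_def real_scaleR_def[symmetric]
  by (intro ballI smooth_on_scaleR open_chart_image smooth_fun_smooth assms)

lemma vfields_add:
  assumes "X \<in> vfields A" "Y \<in> vfields A"
  shows "X + Y \<in> vfields A"
proof -
  have "smooth_on (snd c ` fst c) (\<lambda>u. (X + Y) (chart_inv c u) c)" if "c \<in> A" for c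
    unfolding plus_fun_def using that
    by (intro smooth_on_add open_chart_image vfields_smooth assms)
  moreover have "(X + Y) p \<in> tangent_space A p" for p
    using tangent_space_add[OF assms[THEN vfields_tangent], of p] by (simp only: plus_fun_apply)
  ultimately show ?thesis unfolding vfields_def by blast
qed

lemma vfields_scale:
  assumes "smooth_fun A f" "X \<in> vfields A"
  shows "f *\<^sub>F X \<in> vfields A"
proof -
  have "smooth_on (snd c ` fst c) (\<lambda>u. (f *\<^sub>F X) (chart_inv c u) c)" if "c \<in> A" for c
    unfolding vf_scale_def using that
    by (intro smooth_on_scaleR open_chart_image vfields_smooth smooth_fun_smooth assms)
  moreover have "(f *\<^sub>F X) p \<in> tangent_space A p" for p
    using tangent_space_scale[OF vfields_tangent[OF assms(2)], of "f p" p] by (simp only: vf_scale_def)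
  ultimately show ?thesis unfolding vfields_def by blast
qed

lemma vf_minus_eq: "X - Y = X + (- 1) *\<^sub>C Y"
  by (intro ext) (simp add: vf_scale_def)

lemma vfields_diff: "X \<in> vfields A \<Longrightarrow> Y \<in> vfields A \<Longrightarrow> X - Y \<in> vfields A"
  unfolding vf_minus_eq by (intro vfields_add vfields_scale smooth_fun_const)

lemma vf_deriv_const: "vf_deriv A X (\<lambda>_. a) = 0"
  unfolding vf_deriv_def Let_def o_def by (simp add: fun_eq_iff)

lemma smooth_fun_differentiable:
  "smooth_fun A f \<Longrightarrow> c \<in> A \<Longrightarrow> p \<in> fst c \<Longrightarrow> (f \<circ> chart_inv c) differentiable (at (snd c p))"
  unfolding smooth_fun_def using smooth_on_differentiable by blast

text \<open>The derivative along a vector field may be computed in any chart.\<close>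

lemma vf_deriv_chart:
  assumes f: "smooth_fun A f" and X: "X \<in> vfields A" and c: "c \<in> A" "p \<in> fst c"
  shows "vf_deriv A X f p = frechet_derivative (f \<circ> chart_inv c) (at (snd c p)) (X p c)"
proof -
  define d where "d = chart_at A p"
  have d: "d \<in> A" "p \<in> fst d" using chart_at by (auto simp: d_def)
  let ?t = "snd d \<circ> chart_inv c"
  have t: "(?t has_derivative frechet_derivative ?t (at (snd c p))) (at (snd c p))"
    using transition_differentiable[OF c(1) d(1) c(2) d(2)] frechet_derivative_works by blast
  have tp: "?t (snd c p) = snd d p"
    using chart_inv_chart c by simp
  have fd: "((f \<circ> chart_inv d) has_derivative frechet_derivative (f \<circ> chart_inv d) (at (snd d p)))
      (at (?t (snd c p)))"
    unfolding tp using smooth_fun_differentiable[OF f d] frechet_derivative_works by blast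
  have "((\<lambda>u. (f \<circ> chart_inv d) (?t u)) has_derivative
      (\<lambda>v. frechet_derivative (f \<circ> chart_inv d) (at (snd d p)) (frechet_derivative ?t (at (snd c p)) v)))
      (at (snd c p))"
    using has_derivative_compose[OF t fd] .
  then have "((f \<circ> chart_inv c) has_derivative
      (\<lambda>v. frechet_derivative (f \<circ> chart_inv d) (at (snd d p)) (frechet_derivative ?t (at (snd c p)) v)))
      (at (snd c p))"
  proof (rule has_derivative_transform_within_open)
    show "open (snd c ` (fst c \<inter> fst d))"
      using open_chart_image_Int c d open_chart by blast
    show "snd c p \<in> snd c ` (fst c \<inter> fst d)" using c d by blast
    show "(f \<circ> chart_inv d) (?t u) = (f \<circ> chart_inv c) u" if "u \<in> snd c ` (fst c \<inter> fst d)" for u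
    proof -
      from that obtain q where q: "q \<in> fst c" "q \<in> fst d" "u = snd c q" by blast
      then show ?thesis
        using chart_inv_chart[OF c(1) q(1)] chart_inv_chart[OF d(1) q(2)] by simp
    qed
  qed
  from fun_cong[OF frechet_derivative_at[OF this], of "X p c", symmetric]
  have "frechet_derivative (f \<circ> chart_inv c) (at (snd c p)) (X p c) =
      frechet_derivative (f \<circ> chart_inv d) (at (snd d p)) (frechet_derivative ?t (at (snd c p)) (X p c))" .
  also have "frechet_derivative ?t (at (snd c p)) (X p c) = X p d"
    by (rule tangent_spaceD(2)[OF vfields_tangent[OF X] c(1) d(1) c(2) d(2), symmetric])
  finally show ?thesis unfolding vf_deriv_def Let_def d_def ..
qed

text \<open>In a chart, the second derivatives of \<open>f\<close> cancel by symmetry, and the first derivatives of the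
  fields are what defines the bracket.\<close>

lemma vf_deriv_lie_bracket:
  assumes X: "X \<in> vfields A" and Y: "Y \<in> vfields A" and f: "smooth_fun A f"
    and br: "lie_bracket A X Y \<in> vfields A"
    and Xf: "smooth_fun A (vf_deriv A X f)" and Yf: "smooth_fun A (vf_deriv A Y f)"
  shows "vf_deriv A (lie_bracket A X Y) f =
    vf_deriv A X (vf_deriv A Y f) - vf_deriv A Y (vf_deriv A X f)"
proof
  fix p
  define c where "c = chart_at A p"
  have c: "c \<in> A" "p \<in> fst c" using chart_at by (auto simp: c_def)
  define S where "S = snd c ` fst c"
  have S: "open S" "snd c p \<in> S" using c open_chart_image by (auto simp: S_def)
  define F where "F = f \<circ> chart_inv c"
  have F: "k_smooth_on 2 S F"
    using f c unfolding smooth_fun_def smooth_on_def S_def F_def by blast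
  have linF: "linear (frechet_derivative F (at (snd c p)))"
    using smooth_fun_differentiable[OF f c] unfolding F_def by (rule linear_frechet_derivative)
  have second: "vf_deriv A V (vf_deriv A W f) p =
      frechet_derivative (\<lambda>u. frechet_derivative F (at u) (W p c)) (at (snd c p)) (V p c) +
      frechet_derivative F (at (snd c p))
        (frechet_derivative (\<lambda>u. W (chart_inv c u) c) (at (snd c p)) (V p c))"
    if V: "V \<in> vfields A" and W: "W \<in> vfields A" and Wf: "smooth_fun A (vf_deriv A W f)" for V W
  proof -
    have "smooth_on S (\<lambda>u. W (chart_inv c u) c)"
      using W c unfolding vfields_def S_def by blast
    then have "((\<lambda>u. W (chart_inv c u) c) has_derivative
        frechet_derivative (\<lambda>u. W (chart_inv c u) c) (at (snd c p))) (at (snd c p))"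
      using smooth_on_differentiable S(2) frechet_derivative_works by blast
    from has_derivative_derivative_along[OF F S this]
    have "((\<lambda>u. frechet_derivative F (at u) (W (chart_inv c u) c)) has_derivative
        (\<lambda>h. frechet_derivative (\<lambda>u. frechet_derivative F (at u) (W p c)) (at (snd c p)) h +
         frechet_derivative F (at (snd c p))
           (frechet_derivative (\<lambda>u. W (chart_inv c u) c) (at (snd c p)) h))) (at (snd c p))"
      using chart_inv_chart[OF c] by simp
    then have "((vf_deriv A W f \<circ> chart_inv c) has_derivative
        (\<lambda>h. frechet_derivative (\<lambda>u. frechet_derivative F (at u) (W p c)) (at (snd c p)) h +
         frechet_derivative F (at (snd c p))
           (frechet_derivative (\<lambda>u. W (chart_inv c u) c) (at (snd c p)) h))) (at (snd c p))"
    proof (rule has_derivative_transform_within_open[OF _ S])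
      fix u assume "u \<in> S"
      then obtain q where q: "q \<in> fst c" "u = snd c q" unfolding S_def by blast
      then show "frechet_derivative F (at u) (W (chart_inv c u) c) = (vf_deriv A W f \<circ> chart_inv c) u"
        using vf_deriv_chart[OF f W c(1) q(1)] chart_inv_chart[OF c(1) q(1)] by (simp add: F_def)
    qed
    from fun_cong[OF frechet_derivative_at[OF this], of "V p c"] vf_deriv_chart[OF Wf V c]
    show ?thesis by simp
  qed
  have "lie_bracket A X Y p c = frechet_derivative (\<lambda>u. Y (chart_inv c u) c) (at (snd c p)) (X p c)
        - frechet_derivative (\<lambda>u. X (chart_inv c u) c) (at (snd c p)) (Y p c)"
    using c unfolding lie_bracket_def by simp
  then show "vf_deriv A (lie_bracket A X Y) f p =
      (vf_deriv A X (vf_deriv A Y f) - vf_deriv A Y (vf_deriv A X f)) p"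
    using second[OF X Y Yf] second[OF Y X Xf] vf_deriv_chart[OF f br c]
      second_derivative_symmetric[OF F S, of "X p c" "Y p c"]
    by (simp add: linear_diff[OF linF[unfolded F_def]] F_def)
qed

end

section \<open>Orthonormal frames of a Lorentzian three-manifold\<close>

text \<open>A Lorentzian three-manifold with a global smooth orthonormal frame whose last member is
  timelike, and its Levi-Civita connection \<open>D\<close>.\<close>

locale lorentz_frame = manifold A
  for A :: "('a::topological_space, real^3) chart set" +
  fixes g :: "('a, real^3) metric"
    and D :: "('a, real^3) vfield \<Rightarrow> ('a, real^3) vfield \<Rightarrow> ('a, real^3) vfield"
    and e1 e2 e3 :: "('a, real^3) vfield"
  assumes lorentzian: "lorentzian_metric A g"
    and connection: "levi_civita A g D"
    and frame: "e1 \<in> vfields A" "e2 \<in> vfields A" "e3 \<in> vfields A"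
    and orthonormal: "\<And>p. g p (e1 p) (e1 p) = 1" "\<And>p. g p (e2 p) (e2 p) = 1"
      "\<And>p. g p (e3 p) (e3 p) = - 1" "\<And>p. g p (e1 p) (e2 p) = 0"
      "\<And>p. g p (e1 p) (e3 p) = 0" "\<And>p. g p (e2 p) (e3 p) = 0"
begin

lemmas lorentzian_at = spec[OF conjunct2[OF lorentzian[unfolded lorentzian_metric_def]]]

lemma g_sym: "u \<in> tangent_space A p \<Longrightarrow> v \<in> tangent_space A p \<Longrightarrow> g p u v = g p v u"
  by (rule bspec[OF bspec[OF conjunct1[OF lorentzian_at]]])

lemma g_linear:
  "u \<in> tangent_space A p \<Longrightarrow> v \<in> tangent_space A p \<Longrightarrow> w \<in> tangent_space A p \<Longrightarrow>
    g p (\<lambda>c. a *\<^sub>R u c + b *\<^sub>R v c) w = a * g p u w + b * g p v w"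
  by (rule spec[OF spec[OF bspec[OF bspec[OF bspec[OF conjunct1[OF conjunct2[OF lorentzian_at]]]]]]])

lemma g_add:
  "u \<in> tangent_space A p \<Longrightarrow> v \<in> tangent_space A p \<Longrightarrow> w \<in> tangent_space A p \<Longrightarrow>
    g p (u + v) w = g p u w + g p v w"
  using g_linear[of u p v w 1 1] by (simp add: plus_fun_def)

lemma g_scale:
  "u \<in> tangent_space A p \<Longrightarrow> w \<in> tangent_space A p \<Longrightarrow> g p (\<lambda>c. a *\<^sub>R u c) w = a * g p u w"
  using g_linear[of u p u w a 0] by simp

lemma metric_fun_sym:
  "X \<in> vfields A \<Longrightarrow> Y \<in> vfields A \<Longrightarrow> metric_fun g X Y = metric_fun g Y X"
  unfolding metric_fun_def using g_sym vfields_tangent by (intro ext) blast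

lemma metric_fun_add:
  "X \<in> vfields A \<Longrightarrow> Y \<in> vfields A \<Longrightarrow> Z \<in> vfields A \<Longrightarrow>
    metric_fun g (X + Y) Z = metric_fun g X Z + metric_fun g Y Z"
  unfolding metric_fun_def by (intro ext) (simp add: g_add vfields_tangent)

lemma metric_fun_scale:
  "X \<in> vfields A \<Longrightarrow> Z \<in> vfields A \<Longrightarrow> metric_fun g (f *\<^sub>F X) Z = f * metric_fun g X Z"
  unfolding metric_fun_def vf_scale_def by (intro ext) (simp add: g_scale vfields_tangent)

lemma metric_fun_smooth: "X \<in> vfields A \<Longrightarrow> Y \<in> vfields A \<Longrightarrow> smooth_fun A (metric_fun g X Y)"
  using lorentzian unfolding lorentzian_metric_def by blast

lemma metric_frame:
  "metric_fun g e1 e1 = (\<lambda>_. 1)" "metric_fun g e2 e2 = (\<lambda>_. 1)" "metric_fun g e3 e3 = (\<lambda>_. - 1)"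
  "metric_fun g e1 e2 = (\<lambda>_. 0)" "metric_fun g e2 e1 = (\<lambda>_. 0)"
  "metric_fun g e1 e3 = (\<lambda>_. 0)" "metric_fun g e3 e1 = (\<lambda>_. 0)"
  "metric_fun g e2 e3 = (\<lambda>_. 0)" "metric_fun g e3 e2 = (\<lambda>_. 0)"
  using metric_fun_sym[OF frame(2) frame(1)] metric_fun_sym[OF frame(3) frame(1)]
    metric_fun_sym[OF frame(3) frame(2)] orthonormal
  unfolding metric_fun_def by simp_all

text \<open>Orthonormality makes the three frame vectors independent in any chart, hence a basis of the
  three-dimensional model space.\<close>

lemma tangent_expansion:
  assumes v: "v \<in> tangent_space A p"
  shows "v = (\<lambda>c. g p v (e1 p) *\<^sub>R e1 p c + g p v (e2 p) *\<^sub>R e2 p c + (- g p v (e3 p)) *\<^sub>R e3 p c)"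
proof -
  define c where "c = chart_at A p"
  have c: "c \<in> A" "p \<in> fst c" using chart_at by (auto simp: c_def)
  define T where "T = (\<lambda>(a::real^3) c. a$1 *\<^sub>R e1 p c + a$2 *\<^sub>R e2 p c + a$3 *\<^sub>R e3 p c)"
  have e: "e1 p \<in> tangent_space A p" "e2 p \<in> tangent_space A p" "e3 p \<in> tangent_space A p"
    using frame vfields_tangent by auto
  have Tsum: "T a = (\<lambda>c. a$1 *\<^sub>R e1 p c) + (\<lambda>c. a$2 *\<^sub>R e2 p c) + (\<lambda>c. a$3 *\<^sub>R e3 p c)" for a
    by (simp add: T_def fun_eq_iff)
  have T: "T a \<in> tangent_space A p" for a
    unfolding Tsum by (intro tangent_space_add tangent_space_scale e)
  have gT: "g p (T a) (e1 p) = a$1" "g p (T a) (e2 p) = a$2" "g p (T a) (e3 p) = - a$3" for a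
    unfolding Tsum using e orthonormal
    by (simp_all add: g_add g_scale tangent_space_add tangent_space_scale g_sym[of "e2 p" p "e1 p"]
        g_sym[of "e3 p" p "e1 p"] g_sym[of "e3 p" p "e2 p"])
  have lin: "linear (\<lambda>a. T a c)"
    by (rule linearI) (simp_all add: T_def algebra_simps)
  have "a = 0" if "T a c = 0" for a
  proof -
    have "T a = 0" using tangent_space_eq_0[OF T c that] .
    moreover have "g p (0 :: ('a, real^3) chart \<Rightarrow> real^3) w = 0" if "w \<in> tangent_space A p" for w
      using g_scale[OF that that, of 0] by (simp add: zero_fun_def)
    ultimately have "a$1 = 0" "a$2 = 0" "a$3 = 0"
      using gT[of a] e by auto
    then show ?thesis by (simp add: vec_eq_iff forall_3)
  qed
  then have "inj (\<lambda>a. T a c)"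
    using linear_injective_0[OF lin] by blast
  then have "surj (\<lambda>a. T a c)"
    using linear_injective_imp_surjective[OF lin] by blast
  then obtain a where a: "v c = T a c" by (metis surjD)
  have "v + (\<lambda>c. (- 1) *\<^sub>R T a c) = 0"
    using a by (intro tangent_space_eq_0[OF _ c] tangent_space_add tangent_space_scale T v) simp
  then have "v = T a"
    by (simp add: fun_eq_iff)
  with gT[of a] show ?thesis by (simp add: T_def)
qed

lemma vf_expansion:
  assumes "X \<in> vfields A"
  shows "X = metric_fun g X e1 *\<^sub>F e1 + metric_fun g X e2 *\<^sub>F e2 +
    ((\<lambda>_. - 1) * metric_fun g X e3) *\<^sub>F e3"
proof
  fix p
  show "X p = (metric_fun g X e1 *\<^sub>F e1 + metric_fun g X e2 *\<^sub>F e2 +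
      ((\<lambda>_. - 1) * metric_fun g X e3) *\<^sub>F e3) p"
    using tangent_expansion[OF vfields_tangent[OF assms, of p]]
    by (auto simp: vf_scale_def metric_fun_def fun_eq_iff)
qed

lemma vf_eqI:
  assumes "X \<in> vfields A" "Y \<in> vfields A"
    and "metric_fun g X e1 = metric_fun g Y e1" "metric_fun g X e2 = metric_fun g Y e2"
      "metric_fun g X e3 = metric_fun g Y e3"
  shows "X = Y"
  using vf_expansion[OF assms(1)] vf_expansion[OF assms(2)] assms(3-) by simp

text \<open>A functional of vector fields that is linear over the smooth functions is determined by its
  values on the frame.\<close>

lemma tensorial_expansion:
  assumes X: "X \<in> vfields A"
    and add: "\<And>X Y. X \<in> vfields A \<Longrightarrow> Y \<in> vfields A \<Longrightarrow> T (X + Y) = T X + T Y"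
    and scale: "\<And>f X. smooth_fun A f \<Longrightarrow> X \<in> vfields A \<Longrightarrow> T (f *\<^sub>F X) = f * T X"
  shows "T X p = metric_fun g X e1 p * T e1 p + metric_fun g X e2 p * T e2 p
    - metric_fun g X e3 p * (T e3 p :: real)"
proof -
  have f: "smooth_fun A (metric_fun g X e1)" "smooth_fun A (metric_fun g X e2)"
    "smooth_fun A ((\<lambda>_. - 1) * metric_fun g X e3)"
    by (intro smooth_fun_mult smooth_fun_const metric_fun_smooth X frame)+
  have "T X = T (metric_fun g X e1 *\<^sub>F e1 + metric_fun g X e2 *\<^sub>F e2 +
      ((\<lambda>_. - 1) * metric_fun g X e3) *\<^sub>F e3)"
    using vf_expansion[OF X] by simp
  also have "\<dots> = metric_fun g X e1 * T e1 + metric_fun g X e2 * T e2 +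
      ((\<lambda>_. - 1) * metric_fun g X e3) * T e3"
    using f frame by (simp only: add scale vfields_add vfields_scale)
  finally show ?thesis by simp
qed

section \<open>Levi-Civita connection and tensoriality of curvature\<close>

lemma conn_closed: "X \<in> vfields A \<Longrightarrow> Y \<in> vfields A \<Longrightarrow> D X Y \<in> vfields A"
  using connection unfolding levi_civita_def affine_connection_def by blast

lemma conn_add_left:
  "X \<in> vfields A \<Longrightarrow> Y \<in> vfields A \<Longrightarrow> Z \<in> vfields A \<Longrightarrow> D (X + Y) Z = D X Z + D Y Z"
  using connection unfolding levi_civita_def affine_connection_def by blast

lemma conn_add_right:
  "X \<in> vfields A \<Longrightarrow> Y \<in> vfields A \<Longrightarrow> Z \<in> vfields A \<Longrightarrow> D X (Y + Z) = D X Y + D X Z"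
  using connection unfolding levi_civita_def affine_connection_def by blast

lemma conn_scale_left:
  "smooth_fun A f \<Longrightarrow> X \<in> vfields A \<Longrightarrow> Y \<in> vfields A \<Longrightarrow> D (f *\<^sub>F X) Y = f *\<^sub>F D X Y"
  using connection unfolding levi_civita_def affine_connection_def by blast

lemma conn_leibniz:
  "smooth_fun A f \<Longrightarrow> X \<in> vfields A \<Longrightarrow> Y \<in> vfields A \<Longrightarrow>
    D X (f *\<^sub>F Y) = vf_deriv A X f *\<^sub>F Y + f *\<^sub>F D X Y"
  using connection unfolding levi_civita_def affine_connection_def by blast

lemma lie_bracket_conn:
  "X \<in> vfields A \<Longrightarrow> Y \<in> vfields A \<Longrightarrow> lie_bracket A X Y = D X Y - D Y X"
  using connection unfolding levi_civita_def by simp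

lemma conn_metric:
  "X \<in> vfields A \<Longrightarrow> Y \<in> vfields A \<Longrightarrow> Z \<in> vfields A \<Longrightarrow>
    vf_deriv A X (metric_fun g Y Z) = metric_fun g (D X Y) Z + metric_fun g Y (D X Z)"
  using connection unfolding levi_civita_def by blast

lemma conn_cscale_right:
  "X \<in> vfields A \<Longrightarrow> Y \<in> vfields A \<Longrightarrow> D X (a *\<^sub>C Y) = a *\<^sub>C D X Y"
  unfolding conn_leibniz[OF smooth_fun_const] vf_deriv_const
  by (simp add: vf_scale_def fun_eq_iff)

lemma conn_diff_left:
  "X \<in> vfields A \<Longrightarrow> Y \<in> vfields A \<Longrightarrow> Z \<in> vfields A \<Longrightarrow> D (X - Y) Z = D X Z - D Y Z"
  unfolding vf_minus_eq by (simp only: conn_add_left conn_scale_left vfields_scale smooth_fun_const)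

lemma lie_bracket_closed: "X \<in> vfields A \<Longrightarrow> Y \<in> vfields A \<Longrightarrow> lie_bracket A X Y \<in> vfields A"
  by (simp only: lie_bracket_conn vfields_diff conn_closed)

text \<open>Since \<open>f = g(f e\<^sub>1, e\<^sub>1)\<close>, compatibility with the metric expresses \<open>X f\<close> by the metric.\<close>

lemma vf_deriv_smooth:
  assumes X: "X \<in> vfields A" and f: "smooth_fun A f"
  shows "smooth_fun A (vf_deriv A X f)"
proof -
  have fe: "f *\<^sub>F e1 \<in> vfields A" using vfields_scale[OF f frame(1)] .
  have "metric_fun g (f *\<^sub>F e1) e1 = f"
    using metric_fun_scale[OF frame(1) frame(1), of f] by (simp add: metric_frame times_fun_def)
  then have "vf_deriv A X f = metric_fun g (D X (f *\<^sub>F e1)) e1 + metric_fun g (f *\<^sub>F e1) (D X e1)"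
    using conn_metric[OF X fe frame(1)] by simp
  then show ?thesis
    by (simp only: smooth_fun_add metric_fun_smooth conn_closed X fe frame)
qed

lemma lie_bracket_add_left:
  "X \<in> vfields A \<Longrightarrow> Y \<in> vfields A \<Longrightarrow> Z \<in> vfields A \<Longrightarrow>
    lie_bracket A (X + Y) Z = lie_bracket A X Z + lie_bracket A Y Z"
  by (simp only: lie_bracket_conn conn_add_left conn_add_right vfields_add) (simp add: algebra_simps)

lemma lie_bracket_scale_left:
  "smooth_fun A f \<Longrightarrow> X \<in> vfields A \<Longrightarrow> Y \<in> vfields A \<Longrightarrow>
    lie_bracket A (f *\<^sub>F X) Y = f *\<^sub>F lie_bracket A X Y - vf_deriv A Y f *\<^sub>F X"
  by (simp only: lie_bracket_conn conn_scale_left conn_leibniz vfields_scale)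
    (simp add: vf_scale_def fun_eq_iff algebra_simps)

lemma curvature_closed:
  "X \<in> vfields A \<Longrightarrow> Y \<in> vfields A \<Longrightarrow> Z \<in> vfields A \<Longrightarrow> curvature A D X Y Z \<in> vfields A"
  unfolding curvature_def by (intro vfields_diff conn_closed lie_bracket_closed)

lemma curvature_add_left:
  "X \<in> vfields A \<Longrightarrow> X' \<in> vfields A \<Longrightarrow> Y \<in> vfields A \<Longrightarrow> Z \<in> vfields A \<Longrightarrow>
    curvature A D (X + X') Y Z = curvature A D X Y Z + curvature A D X' Y Z"
  unfolding curvature_def
  by (simp only: lie_bracket_add_left conn_add_left conn_add_right conn_closed lie_bracket_closed)
    (simp add: algebra_simps)

lemma curvature_add_right:
  "X \<in> vfields A \<Longrightarrow> Y \<in> vfields A \<Longrightarrow> Z \<in> vfields A \<Longrightarrow> Z' \<in> vfields A \<Longrightarrow>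
    curvature A D X Y (Z + Z') = curvature A D X Y Z + curvature A D X Y Z'"
  unfolding curvature_def
  by (simp only: conn_add_right conn_closed lie_bracket_closed) (simp add: algebra_simps)

lemma curvature_scale_left:
  "smooth_fun A f \<Longrightarrow> X \<in> vfields A \<Longrightarrow> Y \<in> vfields A \<Longrightarrow> Z \<in> vfields A \<Longrightarrow>
    curvature A D (f *\<^sub>F X) Y Z = f *\<^sub>F curvature A D X Y Z"
  unfolding curvature_def
  by (simp only: lie_bracket_scale_left conn_scale_left conn_leibniz conn_diff_left conn_closed
      lie_bracket_closed vfields_scale vf_deriv_smooth)
    (simp add: vf_scale_def fun_eq_iff algebra_simps)

lemma curvature_scale_right:
  "smooth_fun A f \<Longrightarrow> X \<in> vfields A \<Longrightarrow> Y \<in> vfields A \<Longrightarrow> Z \<in> vfields A \<Longrightarrow>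
    curvature A D X Y (f *\<^sub>F Z) = f *\<^sub>F curvature A D X Y Z"
  unfolding curvature_def
  by (simp only: conn_leibniz conn_add_right conn_closed
      lie_bracket_closed vfields_scale vf_deriv_smooth vf_deriv_lie_bracket)
    (simp add: vf_scale_def fun_eq_iff algebra_simps)

section \<open>Ricci tensor and Ricci operator\<close>

abbreviation "Ric \<equiv> ricci A g D e1 e2 e3"

lemma ricci_smooth:
  assumes "X \<in> vfields A" "Y \<in> vfields A"
  shows "smooth_fun A (Ric X Y)"
proof -
  have "Ric X Y = (\<lambda>_. - 1) * metric_fun g (curvature A D X e1 Y) e1
      + (\<lambda>_. - 1) * metric_fun g (curvature A D X e2 Y) e2
      + metric_fun g (curvature A D X e3 Y) e3"
    by (simp add: ricci_def fun_eq_iff)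
  then show ?thesis
    using assms frame
    by (simp only: smooth_fun_add smooth_fun_mult smooth_fun_const metric_fun_smooth curvature_closed)
qed

lemma ricci_add_left:
  "X \<in> vfields A \<Longrightarrow> X' \<in> vfields A \<Longrightarrow> Y \<in> vfields A \<Longrightarrow> Ric (X + X') Y = Ric X Y + Ric X' Y"
  unfolding ricci_def
  by (simp only: curvature_add_left metric_fun_add curvature_closed frame) (simp add: algebra_simps)

lemma ricci_add_right:
  "X \<in> vfields A \<Longrightarrow> Y \<in> vfields A \<Longrightarrow> Y' \<in> vfields A \<Longrightarrow> Ric X (Y + Y') = Ric X Y + Ric X Y'"
  unfolding ricci_def
  by (simp only: curvature_add_right metric_fun_add curvature_closed frame) (simp add: algebra_simps)

lemma ricci_scale_left:
  "smooth_fun A f \<Longrightarrow> X \<in> vfields A \<Longrightarrow> Y \<in> vfields A \<Longrightarrow> Ric (f *\<^sub>F X) Y = f * Ric X Y"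
  unfolding ricci_def
  by (simp only: curvature_scale_left metric_fun_scale curvature_closed frame)
    (simp add: fun_eq_iff algebra_simps)

lemma ricci_scale_right:
  "smooth_fun A f \<Longrightarrow> X \<in> vfields A \<Longrightarrow> Y \<in> vfields A \<Longrightarrow> Ric X (f *\<^sub>F Y) = f * Ric X Y"
  unfolding ricci_def
  by (simp only: curvature_scale_right metric_fun_scale curvature_closed frame)
    (simp add: fun_eq_iff algebra_simps)

lemma ricci_expand_left:
  assumes "X \<in> vfields A" "Y \<in> vfields A"
  shows "Ric X Y p = metric_fun g X e1 p * Ric e1 Y p + metric_fun g X e2 p * Ric e2 Y p
    - metric_fun g X e3 p * Ric e3 Y p"
  by (rule tensorial_expansion[where T = "\<lambda>X. Ric X Y"])
    (simp_all only: assms ricci_add_left ricci_scale_left)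

lemma ricci_expand_right:
  assumes "X \<in> vfields A" "Y \<in> vfields A"
  shows "Ric X Y p = metric_fun g Y e1 p * Ric X e1 p + metric_fun g Y e2 p * Ric X e2 p
    - metric_fun g Y e3 p * Ric X e3 p"
  by (rule tensorial_expansion[where T = "\<lambda>Y. Ric X Y"])
    (simp_all only: assms ricci_add_right ricci_scale_right)

text \<open>Raising an index with the frame gives a field representing \<open>\<rho>(X, _)\<close>, and the metric is
  nondegenerate on the frame, so it is the only one.\<close>

lemma ricci_operator_eq:
  assumes X: "X \<in> vfields A"
  shows "ricci_operator A g D e1 e2 e3 X =
    Ric X e1 *\<^sub>F e1 + Ric X e2 *\<^sub>F e2 + ((\<lambda>_. - 1) * Ric X e3) *\<^sub>F e3" (is "_ = ?Z")
  unfolding ricci_operator_def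
proof (rule the_equality)
  have Z: "?Z \<in> vfields A"
    using frame X
    by (intro vfields_add vfields_scale smooth_fun_mult smooth_fun_const ricci_smooth) auto
  have ZY: "metric_fun g ?Z Y = Ric X Y" if Y: "Y \<in> vfields A" for Y
  proof
    fix p
    have "metric_fun g ?Z Y = Ric X e1 * metric_fun g e1 Y + Ric X e2 * metric_fun g e2 Y
        + ((\<lambda>_. - 1) * Ric X e3) * metric_fun g e3 Y"
      using frame X Y
      by (simp only: metric_fun_add metric_fun_scale vfields_add vfields_scale smooth_fun_mult
          smooth_fun_const ricci_smooth)
    then show "metric_fun g ?Z Y p = Ric X Y p"
      using ricci_expand_right[OF X Y, of p] metric_fun_sym[OF Y frame(1)]
        metric_fun_sym[OF Y frame(2)] metric_fun_sym[OF Y frame(3)]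
      by simp
  qed
  show "?Z \<in> vfields A \<and> (\<forall>Y\<in>vfields A. Ric X Y = metric_fun g ?Z Y)"
    using Z ZY by simp
  show "W = ?Z" if "W \<in> vfields A \<and> (\<forall>Y\<in>vfields A. Ric X Y = metric_fun g W Y)" for W
  proof -
    from that frame have "Ric X e1 = metric_fun g W e1" "Ric X e2 = metric_fun g W e2"
      "Ric X e3 = metric_fun g W e3"
      by auto
    with vf_expansion[of W] that show ?thesis by simp
  qed
qed

lemma ricci_square_eq:
  assumes X: "X \<in> vfields A" and Y: "Y \<in> vfields A"
  shows "ricci_square A g D e1 e2 e3 X Y p =
    Ric X e1 p * Ric e1 Y p + Ric X e2 p * Ric e2 Y p - Ric X e3 p * Ric e3 Y p"
proof -
  have "ricci_square A g D e1 e2 e3 X Y =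
      Ric X e1 * Ric e1 Y + Ric X e2 * Ric e2 Y + ((\<lambda>_. - 1) * Ric X e3) * Ric e3 Y"
    unfolding ricci_square_def ricci_operator_eq[OF X] using frame X Y
    by (simp only: ricci_add_left ricci_scale_left vfields_add vfields_scale smooth_fun_mult
        smooth_fun_const ricci_smooth)
  then show ?thesis by simp
qed

section \<open>Constant combinations of the frame\<close>

text \<open>The field with constant components \<open>a\<close>, \<open>b\<close>, \<open>c\<close> in the frame; on a Lie group with a
  left-invariant frame these are the left-invariant fields.\<close>

definition comb :: "real \<Rightarrow> real \<Rightarrow> real \<Rightarrow> ('a, real^3) vfield" where
  "comb a b c = a *\<^sub>C e1 + b *\<^sub>C e2 + c *\<^sub>C e3"

lemma comb_closed: "comb a b c \<in> vfields A"
  unfolding comb_def by (intro vfields_add vfields_scale smooth_fun_const frame)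

lemma comb_add: "comb a b c + comb a' b' c' = comb (a + a') (b + b') (c + c')"
  by (simp add: comb_def vf_scale_def fun_eq_iff algebra_simps)

lemma comb_diff: "comb a b c - comb a' b' c' = comb (a - a') (b - b') (c - c')"
  by (simp add: comb_def vf_scale_def fun_eq_iff algebra_simps)

lemma comb_minus: "- comb a b c = comb (- a) (- b) (- c)"
  by (simp add: comb_def vf_scale_def fun_eq_iff)

lemma comb_scale: "t *\<^sub>C comb a b c = comb (t * a) (t * b) (t * c)"
  by (simp add: comb_def vf_scale_def fun_eq_iff algebra_simps)

lemma metric_comb:
  "metric_fun g (comb a b c) e1 = (\<lambda>_. a)" "metric_fun g (comb a b c) e2 = (\<lambda>_. b)"
  "metric_fun g (comb a b c) e3 = (\<lambda>_. - c)"
  unfolding comb_def using frame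
  by (simp_all only: metric_fun_add metric_fun_scale vfields_add vfields_scale smooth_fun_const
      metric_frame) (simp_all add: fun_eq_iff)

lemma conn_comb_left:
  "Y \<in> vfields A \<Longrightarrow> D (comb a b c) Y = a *\<^sub>C D e1 Y + b *\<^sub>C D e2 Y + c *\<^sub>C D e3 Y"
  unfolding comb_def using frame
  by (simp only: conn_add_left conn_scale_left vfields_add vfields_scale smooth_fun_const)

lemma conn_comb_right:
  "X \<in> vfields A \<Longrightarrow> D X (comb a b c) = a *\<^sub>C D X e1 + b *\<^sub>C D X e2 + c *\<^sub>C D X e3"
  unfolding comb_def using frame
  by (simp only: conn_add_right conn_cscale_right vfields_add vfields_scale smooth_fun_const)

lemma metric_fun_diff:
  "X \<in> vfields A \<Longrightarrow> Y \<in> vfields A \<Longrightarrow> Z \<in> vfields A \<Longrightarrow>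
    metric_fun g (X - Y) Z = metric_fun g X Z - metric_fun g Y Z"
  unfolding vf_minus_eq
  by (simp only: metric_fun_add metric_fun_scale vfields_scale smooth_fun_const) (simp add: fun_eq_iff)

text \<open>The Koszul formula for fields with constant mutual scalar products, where the derivatives of
  these products drop out.\<close>

lemma koszul_constant:
  assumes V: "X \<in> vfields A" "Y \<in> vfields A" "Z \<in> vfields A"
    and c: "metric_fun g X Y = (\<lambda>_. a)" "metric_fun g Y Z = (\<lambda>_. b)" "metric_fun g Z X = (\<lambda>_. c)"
  shows "2 * metric_fun g (D X Y) Z p = metric_fun g (lie_bracket A X Y) Z p
    - metric_fun g (lie_bracket A Y Z) X p + metric_fun g (lie_bracket A Z X) Y p"
proof -
  have "metric_fun g (D X Y) Z p + metric_fun g (D X Z) Y p = 0"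
    using fun_cong[OF conn_metric[OF V(1,2,3)], of p] metric_fun_sym[OF V(2) conn_closed[OF V(1,3)]]
    by (simp add: c vf_deriv_const)
  moreover have "metric_fun g (D Y Z) X p + metric_fun g (D Y X) Z p = 0"
    using fun_cong[OF conn_metric[OF V(2,3,1)], of p] metric_fun_sym[OF V(3) conn_closed[OF V(2,1)]]
    by (simp add: c vf_deriv_const)
  moreover have "metric_fun g (D Z X) Y p + metric_fun g (D Z Y) X p = 0"
    using fun_cong[OF conn_metric[OF V(3,1,2)], of p] metric_fun_sym[OF V(1) conn_closed[OF V(3,2)]]
    by (simp add: c vf_deriv_const)
  ultimately show ?thesis
    using V by (simp add: lie_bracket_conn metric_fun_diff conn_closed)
qed

text \<open>The connection is determined on the frame by the structure constants.\<close>

lemma conn_frame_eqI: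
  assumes XY: "X \<in> {e1, e2, e3}" "Y \<in> {e1, e2, e3}" and U: "U \<in> vfields A"
    and eq: "\<And>Z p. Z \<in> {e1, e2, e3} \<Longrightarrow> 2 * metric_fun g U Z p =
      metric_fun g (lie_bracket A X Y) Z p - metric_fun g (lie_bracket A Y Z) X p
      + metric_fun g (lie_bracket A Z X) Y p"
  shows "D X Y = U"
proof -
  have V: "W \<in> vfields A" if "W \<in> {e1, e2, e3}" for W using that frame by auto
  have const: "\<exists>a. metric_fun g W W' = (\<lambda>_. a)" if "W \<in> {e1, e2, e3}" "W' \<in> {e1, e2, e3}" for W W'
    using that metric_frame by blast
  have "metric_fun g (D X Y) Z = metric_fun g U Z" if Z: "Z \<in> {e1, e2, e3}" for Z
  proof
    fix p
    obtain a b c where "metric_fun g X Y = (\<lambda>_. a)" "metric_fun g Y Z = (\<lambda>_. b)"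
      "metric_fun g Z X = (\<lambda>_. c)"
      using const XY Z by meson
    from koszul_constant[OF V[OF XY(1)] V[OF XY(2)] V[OF Z] this, of p] eq[OF Z, of p]
    show "metric_fun g (D X Y) Z p = metric_fun g U Z p" by simp
  qed
  then show ?thesis using V XY U by (intro vf_eqI conn_closed) auto
qed

end

section \<open>The Lie algebra of \<open>G\<^sub>1\<close>\<close>

text \<open>The frame only has to satisfy the bracket relations; no group structure is used.\<close>

locale lorentz_frame_g1 = lorentz_frame +
  fixes \<alpha> \<beta> :: real
  assumes bracket12: "lie_bracket A e1 e2 = \<alpha> *\<^sub>C e1 - \<beta> *\<^sub>C e3"
    and bracket13: "lie_bracket A e1 e3 = (- \<alpha>) *\<^sub>C e1 - \<beta> *\<^sub>C e2"
    and bracket23: "lie_bracket A e2 e3 = \<beta> *\<^sub>C e1 + \<alpha> *\<^sub>C e2 + \<alpha> *\<^sub>C e3"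
begin

lemma brackets:
  "lie_bracket A e1 e1 = comb 0 0 0" "lie_bracket A e2 e2 = comb 0 0 0"
  "lie_bracket A e3 e3 = comb 0 0 0"
  "lie_bracket A e1 e2 = comb \<alpha> 0 (- \<beta>)" "lie_bracket A e2 e1 = comb (- \<alpha>) 0 \<beta>"
  "lie_bracket A e1 e3 = comb (- \<alpha>) (- \<beta>) 0" "lie_bracket A e3 e1 = comb \<alpha> \<beta> 0"
  "lie_bracket A e2 e3 = comb \<beta> \<alpha> \<alpha>" "lie_bracket A e3 e2 = comb (- \<beta>) (- \<alpha>) (- \<alpha>)"
proof -
  have anti: "lie_bracket A X Y = (- 1) *\<^sub>C lie_bracket A Y X"
    if "X \<in> vfields A" "Y \<in> vfields A" for X Y
    using that by (simp add: lie_bracket_conn vf_scale_def fun_eq_iff)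
  show "lie_bracket A e1 e1 = comb 0 0 0" "lie_bracket A e2 e2 = comb 0 0 0"
    "lie_bracket A e3 e3 = comb 0 0 0"
    using frame by (simp_all add: lie_bracket_conn comb_def vf_scale_def fun_eq_iff)
  show 12: "lie_bracket A e1 e2 = comb \<alpha> 0 (- \<beta>)" and 13: "lie_bracket A e1 e3 = comb (- \<alpha>) (- \<beta>) 0"
    and 23: "lie_bracket A e2 e3 = comb \<beta> \<alpha> \<alpha>"
    by (simp_all add: bracket12 bracket13 bracket23 comb_def vf_scale_def fun_eq_iff)
  show "lie_bracket A e2 e1 = comb (- \<alpha>) 0 \<beta>" "lie_bracket A e3 e1 = comb \<alpha> \<beta> 0"
    "lie_bracket A e3 e2 = comb (- \<beta>) (- \<alpha>) (- \<alpha>)"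
    using anti[OF frame(2,1)] anti[OF frame(3,1)] anti[OF frame(3,2)]
    by (simp_all add: 12 13 23 comb_scale)
qed

lemma connection_frame:
  "D e1 e1 = comb 0 (- \<alpha>) (- \<alpha>)" "D e1 e2 = comb \<alpha> 0 (- \<beta> / 2)"
  "D e1 e3 = comb (- \<alpha>) (- \<beta> / 2) 0"
  "D e2 e1 = comb 0 0 (\<beta> / 2)" "D e2 e2 = comb 0 0 \<alpha>" "D e2 e3 = comb (\<beta> / 2) \<alpha> 0"
  "D e3 e1 = comb 0 (\<beta> / 2) 0" "D e3 e2 = comb (- \<beta> / 2) 0 (- \<alpha>)" "D e3 e3 = comb 0 (- \<alpha>) 0"
  by (rule conn_frame_eqI; auto simp: comb_closed brackets metric_comb)+

lemma ricci_frame: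
  "Ric e1 e1 p = - \<beta>\<^sup>2 / 2" "Ric e1 e2 p = - \<alpha> * \<beta>" "Ric e1 e3 p = \<alpha> * \<beta>"
  "Ric e2 e1 p = - \<alpha> * \<beta>" "Ric e2 e2 p = - 2 * \<alpha>\<^sup>2 - \<beta>\<^sup>2 / 2" "Ric e2 e3 p = 2 * \<alpha>\<^sup>2"
  "Ric e3 e1 p = \<alpha> * \<beta>" "Ric e3 e2 p = 2 * \<alpha>\<^sup>2" "Ric e3 e3 p = - 2 * \<alpha>\<^sup>2 + \<beta>\<^sup>2 / 2"
  unfolding ricci_def curvature_def
  by (simp_all add: brackets connection_frame conn_comb_left conn_comb_right frame comb_scale
      comb_add comb_diff comb_minus metric_comb power2_eq_square algebra_simps)

lemma ein2_iff:
  assumes \<alpha>: "\<alpha> \<noteq> 0"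
  shows "ein2 A g D e1 e2 e3 l1 l2 \<longleftrightarrow> \<beta> = 0 \<and> l1 = 0 \<and> l2 = 0"
proof
  assume ein: "ein2 A g D e1 e2 e3 l1 l2"
  fix p :: 'a
  have eq: "ricci_square A g D e1 e2 e3 X Y p + l1 * Ric X Y p + l2 * metric_fun g X Y p = 0"
    if "X \<in> vfields A" "Y \<in> vfields A" for X Y p
    using ein that unfolding ein2_def by blast
  \<comment> \<open>These are the components \<open>(1,2)\<close> and \<open>(2,3)\<close>.\<close>
  have "\<alpha> * (\<beta> * (\<beta>\<^sup>2 - l1)) = 0"
    using eq[OF frame(1,2)]
    by (simp add: ricci_square_eq frame ricci_frame metric_frame power2_eq_square algebra_simps)
  moreover have "\<alpha>\<^sup>2 * (2 * l1 - 3 * \<beta>\<^sup>2) = 0"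
    using eq[OF frame(2,3)]
    by (simp add: ricci_square_eq frame ricci_frame metric_frame power2_eq_square algebra_simps)
  ultimately have "\<beta> = 0 \<or> \<beta>\<^sup>2 = l1" and l1: "2 * l1 = 3 * \<beta>\<^sup>2"
    using \<alpha> by auto
  then have \<beta>: "\<beta> = 0" by auto
  with l1 have "l1 = 0" by simp
  moreover have "l2 = 0"
    using eq[OF frame(1,1)] \<beta> \<open>l1 = 0\<close>
    by (simp add: ricci_square_eq frame ricci_frame metric_frame)
  ultimately show "\<beta> = 0 \<and> l1 = 0 \<and> l2 = 0" using \<beta> by simp
next
  assume *: "\<beta> = 0 \<and> l1 = 0 \<and> l2 = 0"
  show "ein2 A g D e1 e2 e3 l1 l2"
    unfolding ein2_def
  proof (intro ballI allI)
    fix X Y p assume X: "X \<in> vfields A" and Y: "Y \<in> vfields A"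
    \<comment> \<open>Here \<open>\<rho>(X,Y) = - 2 \<alpha>\<^sup>2 g(X,n) g(Y,n)\<close> for the null vector \<open>n = e\<^sub>2 + e\<^sub>3\<close>.\<close>
    have "Ric X e1 p = 0" "Ric X e2 p = - Ric X e3 p" "Ric e2 Y p = - Ric e3 Y p"
      using * by (simp_all add: ricci_expand_left[OF X] ricci_expand_right[OF _ Y] frame ricci_frame)
    then show "ricci_square A g D e1 e2 e3 X Y p + l1 * Ric X Y p + l2 * metric_fun g X Y p = 0"
      using * by (simp add: ricci_square_eq[OF X Y])
  qed
qed

end

theorem theorem2p3:
  fixes G :: "('a::{t2_space,second_countable_topology}, 'm) monoid_scheme"
    and A :: "('a, real^3) chart set"
    and g :: "('a, real^3) metric"
    and D :: "('a, real^3) vfield \<Rightarrow> ('a, real^3) vfield \<Rightarrow> ('a, real^3) vfield"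
    and e1 e2 e3 :: "('a, real^3) vfield"
    and \<alpha> \<beta> l1 l2 :: real
  assumes "\<alpha> \<noteq> 0"
    and "lie_group G A"
    and "connected (UNIV :: 'a set)"
    and "simply_connected (UNIV :: 'a set)"
    and "lorentzian_metric A g"
    and "left_invariant_metric G A g"
    and "pseudo_orthonormal_basis G A g e1 e2 e3"
    and "lie_bracket A e1 e2 = \<alpha> *\<^sub>C e1 - \<beta> *\<^sub>C e3"
    and "lie_bracket A e1 e3 = (- \<alpha>) *\<^sub>C e1 - \<beta> *\<^sub>C e2"
    and "lie_bracket A e2 e3 = \<beta> *\<^sub>C e1 + \<alpha> *\<^sub>C e2 + \<alpha> *\<^sub>C e3"
    and "levi_civita A g D"
  shows "ein2 A g D e1 e2 e3 l1 l2 \<longleftrightarrow> \<beta> = 0 \<and> \<alpha> \<noteq> 0 \<and> l1 = 0 \<and> l2 = 0"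
proof -
  have frame: "e1 \<in> vfields A" "e2 \<in> vfields A" "e3 \<in> vfields A"
    using assms(7) unfolding pseudo_orthonormal_basis_def lie_algebra_def by auto
  interpret lorentz_frame_g1 A g D e1 e2 e3 \<alpha> \<beta>
    using assms(2,5,7,8,9,10,11) frame
    by unfold_locales (auto simp: lie_group_def pseudo_orthonormal_basis_def)
  show ?thesis using ein2_iff[OF assms(1)] assms(1) by simp
qed

end
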